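(* Fix $c>0$ and one of the six models. For every $N$ and every $1\le N_1,N_2\le N-1$ with $N_1+N_2=N$, $$\mathbb{E}\big[H(\mathbb{G}(N,\lfloor cN\rfloor))\big]\ge\mathbb{E}\big[H(\mathbb{G}(N_1,\mathcal{M}_1))\big]+\mathbb{E}\big[H(\mathbb{G}(N_2,\mathcal{M}_2))\big],$$ where $\mathcal{M}_1\sim\mathrm{Bi}(\lfloor cN\rfloor,N_1/N)$ and $\mathcal{M}_2=\lfloor cN\rfloor-\mathcal{M}_1\sim\mathrm{Bi}(\lfloor cN\rfloor,N_2/N)$. Additionally, for the Coloring, K-SAT and NAE-K-SAT models, $$p(N,\lfloor cN\rfloor)\ge\mathbb{P}\Big(H\big(\mathbb{G}(N_1,\mathcal{M}_1)\oplus\mathbb{G}(N_2,\mathcal{M}_2)\big)=\mathcal{M}_1+\mathcal{M}_2\Big),$$ where $\oplus$ denotes disjoint union, $\mathbb{G}(N_1,\mathcal{M}_1)$ lives on nodes $\{1,\dots,N_1\}$ and $\mathbb{G}(N_2,\mathcal{M}_2)$ on nodes $\{N_1+1,\dots,N\}$, and given $\mathcal{M}_1$ the two graphs (with their potentials) are generated independently.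
   Context: Let $K\ge2$, $\chi=\{0,\dots,q-1\}$. $\mathbb{G}(n,m)$ on an $n$-element node set $V$: $m$ directed hyperedges chosen independently and uniformly at random from $V^K$. For a hypergraph $G=(V,E)$ with node potentials $H_i$ and edge potentials $H_e:\chi^K\to\mathbb{R}\cup\{-\infty\}$, $H(x)=\sum_{i}H_i(x_i)+\sum_{e\in E}H_e(x_e)$ for $x\in\chi^V$, and $H(G)=\max_xH(x)$. Models: Independent set ($K=2,q=2$, $H_i(1)=1,H_i(0)=0$, $H_e(1,1)=-\infty$, else $0$); MAX-CUT ($K=2,q=2$, $H_i\equiv0$, $H_e(x,y)=\mathbf 1[x\ne y]$); anti-ferromagnetic Ising ($K=2,q=2$, fixed $\beta>0,B\in\mathbb{R}$, $H_i(0)=-B,H_i(1)=B$, $H_e(x,y)=-\beta$ if $x=y$, $\beta$ otherwise); $q$-Coloring ($K=2$, $H_i\equiv0$, $H_e(x,y)=\mathbf 1[x\ne y]$); K-SAT ($q=2$, $H_i\equiv0$, independent uniform $a_e\in\{0,1\}^K$ per hyperedge, $H_e(a_e)=0$, $1$ otherwise); NAE-K-SAT ($H_e(a_e)=H_e(\mathbf1-a_e)=0$, $1$ otherwise). $p(N,M)=\mathbb{P}(H(\mathbb{G}(N,M))=M)$. $\mathrm{Bi}(n,\theta)$ is the binomial distribution. *)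

theory Defs
  imports "HOL-Probability.Probability"
begin

datatype model = IndSet | MaxCut | Ising real real | Coloring nat | KSAT nat | NAEKSAT nat

fun valid_model :: "model \<Rightarrow> bool" where
  "valid_model (Ising \<beta> B) = (\<beta> > 0)"
| "valid_model (Coloring q) = (q \<ge> 2)"
| "valid_model (KSAT K) = (K \<ge> 2)"
| "valid_model (NAEKSAT K) = (K \<ge> 2)"
| "valid_model _ = True"

fun arity :: "model \<Rightarrow> nat" where
  "arity (KSAT K) = K"
| "arity (NAEKSAT K) = K"
| "arity _ = 2"

fun nstates :: "model \<Rightarrow> nat" where
  "nstates (Coloring q) = q"
| "nstates _ = 2"

fun hnode :: "model \<Rightarrow> nat \<Rightarrow> ereal" where
  "hnode IndSet v = (if v = 1 then 1 else 0)"
| "hnode (Ising \<beta> B) v = (if v = 0 then ereal (- B) else ereal B)"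
| "hnode _ v = 0"

text \<open>Edge potential H_e, applied to the (random) sign vector a_e (a bool list,
True = 1, only used for K-SAT / NAE-K-SAT) and the spins x_e of the edge's nodes.\<close>
fun hedge :: "model \<Rightarrow> bool list \<Rightarrow> nat list \<Rightarrow> ereal" where
  "hedge IndSet a xs = (if xs ! 0 = 1 \<and> xs ! 1 = 1 then - \<infinity> else 0)"
| "hedge MaxCut a xs = (if xs ! 0 \<noteq> xs ! 1 then 1 else 0)"
| "hedge (Ising \<beta> B) a xs = (if xs ! 0 = xs ! 1 then ereal (- \<beta>) else ereal \<beta>)"
| "hedge (Coloring q) a xs = (if xs ! 0 \<noteq> xs ! 1 then 1 else 0)"
| "hedge (KSAT K) a xs = (if xs = map of_bool a then 0 else 1)"
| "hedge (NAEKSAT K) a xs =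
     (if xs = map of_bool a \<or> xs = map (\<lambda>b. of_bool (\<not> b)) a then 0 else 1)"

text \<open>A hyperedge is a pair (ordered list of K nodes, sign vector a_e).\<close>
type_synonym edge = "nat list \<times> bool list"

text \<open>Distribution of the sign vector: uniform on {0,1}^K for K-SAT/NAE-K-SAT,
irrelevant (deterministic) otherwise.\<close>
definition sign_pmf :: "model \<Rightarrow> bool list pmf" where
  "sign_pmf m = (case m of
      KSAT K \<Rightarrow> pmf_of_set {a. length a = K}
    | NAEKSAT K \<Rightarrow> pmf_of_set {a. length a = K}
    | _ \<Rightarrow> return_pmf (replicate (arity m) False))"

definition edge_pmf :: "model \<Rightarrow> nat set \<Rightarrow> edge pmf" where
  "edge_pmf m V = pair_pmf (pmf_of_set {xs. set xs \<subseteq> V \<and> length xs = arity m}) (sign_pmf m)"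

fun rgraph :: "model \<Rightarrow> nat set \<Rightarrow> nat \<Rightarrow> edge list pmf" where
  "rgraph m V 0 = return_pmf []"
| "rgraph m V (Suc M) = bind_pmf (edge_pmf m V) (\<lambda>e. map_pmf (\<lambda>es. e # es) (rgraph m V M))"

definition Hx :: "model \<Rightarrow> nat set \<Rightarrow> edge list \<Rightarrow> (nat \<Rightarrow> nat) \<Rightarrow> ereal" where
  "Hx m V E x = (\<Sum>i\<in>V. hnode m (x i)) + (\<Sum>e\<leftarrow>E. hedge m (snd e) (map x (fst e)))"

definition HG :: "model \<Rightarrow> nat set \<Rightarrow> edge list \<Rightarrow> ereal" where
  "HG m V E = Max (Hx m V E ` (PiE V (\<lambda>_. {..<nstates m})))"

text \<open>E[H(G(n,M))] for a random number of edges with law Mdist (H is finite in all six models).\<close>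
definition EH :: "model \<Rightarrow> nat set \<Rightarrow> nat pmf \<Rightarrow> real" where
  "EH m V Mdist = measure_pmf.expectation (bind_pmf Mdist (rgraph m V)) (\<lambda>E. real_of_ereal (HG m V E))"

definition psat :: "model \<Rightarrow> nat \<Rightarrow> nat \<Rightarrow> real" where
  "psat m N M = measure_pmf.prob (rgraph m {..<N} M) {E. HG m {..<N} E = ereal (real M)}"

definition is_csp :: "model \<Rightarrow> bool" where
  "is_csp m = (case m of Coloring _ \<Rightarrow> True | KSAT _ \<Rightarrow> True | NAEKSAT _ \<Rightarrow> True | _ \<Rightarrow> False)"

end

theory Submission
  imports Defs
begin

text \<open>
  Distributing \<open>n\<close> hyperedges binomially over two disjoint node sets \<open>V1\<close> and \<open>V2\<close> amounts to
  drawing \<open>n\<close> independent hyperedges from the mixture that picks \<open>V1\<close> with probability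
  \<open>|V1| / |V|\<close>, where \<open>V = V1 \<union> V2\<close>. The maximal energy is stochastically larger for uniform
  hyperedges on \<open>V\<close>, which gives both claims, and it suffices to exchange one hyperedge at a time.
  In all six models an edge potential takes two values, the lower one when the hyperedge is
  violated. So, unless it is certain, the event that the maximum stays below \<open>t\<close> after adding a
  hyperedge says that the latter is violated by every assignment in some superlevel set \<open>X\<close> of the
  old energy. Given the nodes of the hyperedge, the probability of this is a constant if they all
  lie in one block of a certain family of disjoint node sets, and zero otherwise: the blocks consist
  of the nodes frozen on \<open>X\<close> (independent set, K-SAT), or are the classes of nodes whose spins are
  equal (MAX-CUT, Ising, coloring) or equal up to a fixed relative flip (NAE-K-SAT) throughout \<open>X\<close>.
  But \<open>K\<close> independent nodes with law \<open>\<nu>\<close> lie in one block with probability \<open>\<Sum>C. \<nu>(C) ^ K\<close>, which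
  is convex in \<open>\<nu>\<close>, and the uniform law on \<open>V\<close> is the mixture of those on \<open>V1\<close> and \<open>V2\<close>.
\<close>

subsection \<open>Stochastic order\<close>

definition stoch_le :: "'a::linorder pmf \<Rightarrow> 'a pmf \<Rightarrow> bool" where
  "stoch_le p q \<longleftrightarrow> (\<forall>t. measure_pmf.prob p {t..} \<le> measure_pmf.prob q {t..})"

lemma stoch_le_iff_emeasure: "stoch_le p q \<longleftrightarrow> (\<forall>t. emeasure p {t..} \<le> emeasure q {t..})"
  by (simp add: stoch_le_def measure_pmf.emeasure_eq_measure)

lemma stoch_le_trans [trans]: "stoch_le p q \<Longrightarrow> stoch_le q r \<Longrightarrow> stoch_le p r"
  unfolding stoch_le_def by (meson order_trans)

lemma stoch_le_bind_pmf:
  assumes "\<And>x. stoch_le (f x) (g x)"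
  shows "stoch_le (bind_pmf p f) (bind_pmf p g)"
  using assms by (auto simp: stoch_le_iff_emeasure intro: nn_integral_mono)

lemma map_replicate_pmf_Suc:
  "map_pmf f (replicate_pmf (Suc n) p) = bind_pmf p (\<lambda>x. map_pmf (\<lambda>xs. f (x # xs)) (replicate_pmf n p))"
  by (simp add: map_pmf_def bind_assoc_pmf bind_return_pmf)

lemma stoch_le_map_replicate_pmf:
  fixes f :: "'a list \<Rightarrow> 'b::linorder"
  assumes "\<And>xs ys. mset xs = mset ys \<Longrightarrow> f xs = f ys"
    and "\<And>xs. stoch_le (map_pmf (\<lambda>x. f (x # xs)) p) (map_pmf (\<lambda>x. f (x # xs)) q)"
  shows "stoch_le (map_pmf f (replicate_pmf n p)) (map_pmf f (replicate_pmf n q))"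
  using assms
proof (induction n arbitrary: f)
  case 0
  show ?case by (simp add: stoch_le_def)
next
  case (Suc n)
  have exchange_tail: "stoch_le (map_pmf (\<lambda>xs. f (x # xs)) (replicate_pmf n p))
      (map_pmf (\<lambda>xs. f (x # xs)) (replicate_pmf n q))" for x
  proof (rule Suc.IH)
    show "f (x # xs) = f (x # ys)" if "mset xs = mset ys" for xs ys
      using that by (intro Suc.prems(1)) simp
    have "f (x # y # xs) = f (y # x # xs)" for y xs
      by (rule Suc.prems(1)) simp
    then show "stoch_le (map_pmf (\<lambda>y. f (x # y # xs)) p) (map_pmf (\<lambda>y. f (x # y # xs)) q)" for xs
      using Suc.prems(2)[of "x # xs"] by simp
  qed
  have commute: "bind_pmf r (\<lambda>x. map_pmf (\<lambda>xs. f (x # xs)) s) =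
      bind_pmf s (\<lambda>xs. map_pmf (\<lambda>x. f (x # xs)) r)" for r s
    unfolding map_pmf_def by (rule bind_commute_pmf)
  have "stoch_le (map_pmf f (replicate_pmf (Suc n) p))
      (bind_pmf p (\<lambda>x. map_pmf (\<lambda>xs. f (x # xs)) (replicate_pmf n q)))"
    unfolding map_replicate_pmf_Suc by (intro stoch_le_bind_pmf exchange_tail)
  also have "stoch_le \<dots> (bind_pmf q (\<lambda>x. map_pmf (\<lambda>xs. f (x # xs)) (replicate_pmf n q)))"
    unfolding commute by (intro stoch_le_bind_pmf Suc.prems(2))
  finally show ?case
    unfolding map_replicate_pmf_Suc .
qed

lemma nn_integral_eq_nn_integral_tail:
  assumes "sigma_finite_measure M" and [measurable]: "f \<in> borel_measurable M"
    and nonneg: "\<And>x. x \<in> space M \<Longrightarrow> 0 \<le> f x"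
  shows "(\<integral>\<^sup>+x. ennreal (f x) \<partial>M) = (\<integral>\<^sup>+t\<in>{0..}. emeasure M {x \<in> space M. t \<le> f x} \<partial>lborel)"
proof -
  interpret sigma_finite_measure M by fact
  interpret pair_sigma_finite lborel M ..
  have "(\<integral>\<^sup>+x. ennreal (f x) \<partial>M) = (\<integral>\<^sup>+x. \<integral>\<^sup>+t. indicator {0..f x} t \<partial>lborel \<partial>M)"
    using nonneg by (intro nn_integral_cong) simp
  also have "\<dots> = (\<integral>\<^sup>+t. \<integral>\<^sup>+x. indicator {0..f x} t \<partial>M \<partial>lborel)"
    unfolding indicator_def atLeastAtMost_iff by (rule Fubini') measurable
  also have "\<dots> = (\<integral>\<^sup>+t\<in>{0..}. emeasure M {x \<in> space M. t \<le> f x} \<partial>lborel)"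
  proof (intro nn_integral_cong)
    fix t
    have "(\<integral>\<^sup>+x. indicator {0..f x} t \<partial>M) =
        (\<integral>\<^sup>+x. indicator {0..} t * indicator {x \<in> space M. t \<le> f x} x \<partial>M)"
      by (intro nn_integral_cong) (simp split: split_indicator)
    then show "(\<integral>\<^sup>+x. indicator {0..f x} t \<partial>M) =
        emeasure M {x \<in> space M. t \<le> f x} * indicator {0..} t"
      by (simp add: nn_integral_cmult mult.commute)
  qed
  finally show ?thesis .
qed

lemma stoch_le_imp_expectation_le:
  fixes p q :: "real pmf"
  assumes dominated: "stoch_le p q" and integrable: "integrable p (\<lambda>x. x)" "integrable q (\<lambda>x. x)"
    and bounded_below: "\<And>x. x \<in> set_pmf p \<union> set_pmf q \<Longrightarrow> a \<le> x"
  shows "measure_pmf.expectation p (\<lambda>x. x) \<le> measure_pmf.expectation q (\<lambda>x. x)"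
proof -
  have tail: "ennreal (measure_pmf.expectation r (\<lambda>x. x) - a) =
      (\<integral>\<^sup>+t\<in>{0..}. emeasure r {a + t..} \<partial>lborel)"
    if supported: "integrable r (\<lambda>x. x)" "\<And>x. x \<in> set_pmf r \<Longrightarrow> a \<le> x" for r :: "real pmf"
  proof -
    have "ennreal (measure_pmf.expectation r (\<lambda>x. x) - a) =
        ennreal (measure_pmf.expectation r (\<lambda>x. x - a))"
      using supported(1) by simp
    also have "\<dots> = (\<integral>\<^sup>+x. ennreal (max 0 (x - a)) \<partial>r)"
      using supported by (subst nn_integral_eq_integral[symmetric])
        (auto intro!: nn_integral_cong_AE AE_pmfI simp: max_def)
    also have "\<dots> = (\<integral>\<^sup>+t\<in>{0..}. emeasure r {x. t \<le> max 0 (x - a)} \<partial>lborel)"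
      using nn_integral_eq_nn_integral_tail[of "measure_pmf r" "\<lambda>x. max 0 (x - a)"]
      by (simp add: measure_pmf.sigma_finite_measure_axioms)
    also have "\<dots> = (\<integral>\<^sup>+t\<in>{0..}. emeasure r {a + t..} \<partial>lborel)"
      using supported(2)
      by (intro nn_integral_cong emeasure_eq_AE arg_cong2[where f = "(*)"] refl AE_pmfI)
        (auto simp: max_def)
    finally show ?thesis .
  qed
  have "ennreal (measure_pmf.expectation p (\<lambda>x. x) - a) \<le>
      ennreal (measure_pmf.expectation q (\<lambda>x. x) - a)"
    using dominated bounded_below unfolding tail[OF integrable(1)]
    by (subst (1 2) tail)
      (auto simp: integrable stoch_le_iff_emeasure intro!: nn_integral_mono mult_right_mono)
  moreover have "a \<le> measure_pmf.expectation q (\<lambda>x. x)"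
    using integrable(2) bounded_below by (intro measure_pmf.integral_ge_const) (auto intro: AE_pmfI)
  ultimately show ?thesis
    by simp
qed

lemma stoch_le_map_real_of_ereal:
  assumes dominated: "stoch_le p q" and finite: "\<And>x. x \<in> set_pmf p \<union> set_pmf q \<Longrightarrow> \<bar>x\<bar> \<noteq> \<infinity>"
  shows "stoch_le (map_pmf real_of_ereal p) (map_pmf real_of_ereal q)"
proof -
  have "measure_pmf.prob (map_pmf real_of_ereal r) {t..} = measure_pmf.prob r {ereal t..}"
    if "\<And>x. x \<in> set_pmf r \<Longrightarrow> \<bar>x\<bar> \<noteq> \<infinity>" for r t
    unfolding measure_map_pmf using that
    by (intro measure_pmf.finite_measure_eq_AE AE_pmfI) (auto simp: real_of_ereal_ord_simps)
  then show ?thesis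
    using dominated finite by (simp add: stoch_le_def)
qed

subsection \<open>Mixtures and independent samples\<close>

lemma prob_bind_pmf:
  "measure_pmf.prob (bind_pmf p f) S = measure_pmf.expectation p (\<lambda>x. measure_pmf.prob (f x) S)"
  unfolding measure_pmf_bind
  by (rule measure_pmf.measure_bind[where N = "count_space UNIV"])
    (simp_all add: measure_pmf_in_subprob_algebra)

definition mixture_pmf :: "real \<Rightarrow> 'a pmf \<Rightarrow> 'a pmf \<Rightarrow> 'a pmf" where
  "mixture_pmf \<theta> p q = bind_pmf (bernoulli_pmf \<theta>) (\<lambda>b. if b then p else q)"

lemma bind_mixture_pmf:
  "bind_pmf (mixture_pmf \<theta> p q) f = bind_pmf (bernoulli_pmf \<theta>) (\<lambda>b. bind_pmf (if b then p else q) f)"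
  by (simp add: mixture_pmf_def bind_assoc_pmf)

lemma pmf_mixture_pmf:
  "\<theta> \<in> {0..1} \<Longrightarrow> pmf (mixture_pmf \<theta> p q) x = \<theta> * pmf p x + (1 - \<theta>) * pmf q x"
  by (simp add: mixture_pmf_def pmf_bind)

lemma prob_mixture_pmf:
  assumes "\<theta> \<in> {0..1}"
  shows "measure_pmf.prob (mixture_pmf \<theta> p q) S =
    \<theta> * measure_pmf.prob p S + (1 - \<theta>) * measure_pmf.prob q S"
  using assms by (simp add: mixture_pmf_def prob_bind_pmf)

lemma pmf_of_set_Un:
  assumes "finite A" "finite B" "A \<noteq> {}" "B \<noteq> {}" "A \<inter> B = {}"
  shows "pmf_of_set (A \<union> B) = mixture_pmf (card A / card (A \<union> B)) (pmf_of_set A) (pmf_of_set B)"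
proof -
  have card_pos: "card (A \<union> B) = card A + card B" "card A > 0" "card B > 0"
    using assms by (auto simp: card_Un_disjoint card_gt_0_iff)
  have weight: "card A / card (A \<union> B) \<in> {0..1}" "1 - card A / card (A \<union> B) = card B / card (A \<union> B)"
    using card_pos by (simp_all add: field_simps)
  show ?thesis
    using assms weight card_pos(2,3) by (intro pmf_eqI) (auto simp: pmf_mixture_pmf indicator_def)
qed

lemma bind_map_append_replicate_pmf_left:
  "bind_pmf p (\<lambda>x. map_pmf (\<lambda>(xs, ys). f (x # xs @ ys))
      (pair_pmf (replicate_pmf k p) (replicate_pmf l q))) =
    map_pmf (\<lambda>(xs, ys). f (xs @ ys)) (pair_pmf (replicate_pmf (Suc k) p) (replicate_pmf l q))"
  by (simp add: pair_pmf_def map_pmf_def bind_assoc_pmf bind_return_pmf)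

lemma bind_map_append_replicate_pmf_right:
  assumes symmetric: "\<And>xs ys. mset xs = mset ys \<Longrightarrow> f xs = f ys"
  shows "bind_pmf q (\<lambda>x. map_pmf (\<lambda>(xs, ys). f (x # xs @ ys))
      (pair_pmf (replicate_pmf k p) (replicate_pmf l q))) =
    map_pmf (\<lambda>(xs, ys). f (xs @ ys)) (pair_pmf (replicate_pmf k p) (replicate_pmf (Suc l) q))"
proof -
  have "f (x # xs @ ys) = f (xs @ x # ys)" for x xs ys
    by (rule symmetric) simp
  then show ?thesis
    by (simp add: pair_pmf_def map_pmf_def bind_assoc_pmf bind_return_pmf
        bind_commute_pmf[of "replicate_pmf k p" q])
qed

lemma map_replicate_pmf_mixture_pmf:
  assumes unit: "\<theta> \<in> {0..1}" and symmetric: "\<And>xs ys. mset xs = mset ys \<Longrightarrow> f xs = f ys"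
  shows "map_pmf f (replicate_pmf n (mixture_pmf \<theta> p q)) =
    bind_pmf (binomial_pmf n \<theta>) (\<lambda>k.
      map_pmf (\<lambda>(xs, ys). f (xs @ ys)) (pair_pmf (replicate_pmf k p) (replicate_pmf (n - k) q)))"
  using symmetric
proof (induction n arbitrary: f)
  case 0
  show ?case
    using unit by (simp add: binomial_pmf_0 bind_return_pmf)
next
  case (Suc n)
  let ?joint = "\<lambda>f k l. map_pmf (\<lambda>(xs, ys). f (xs @ ys)) (pair_pmf (replicate_pmf k p) (replicate_pmf l q))"
  have "map_pmf f (replicate_pmf (Suc n) (mixture_pmf \<theta> p q)) =
      bind_pmf (mixture_pmf \<theta> p q) (\<lambda>x. bind_pmf (binomial_pmf n \<theta>) (\<lambda>k.
        ?joint (\<lambda>xs. f (x # xs)) k (n - k)))"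
    unfolding map_replicate_pmf_Suc by (intro bind_pmf_cong refl Suc.IH) (rule Suc.prems, simp)
  also have "\<dots> = bind_pmf (bernoulli_pmf \<theta>) (\<lambda>b. bind_pmf (binomial_pmf n \<theta>) (\<lambda>k.
      bind_pmf (if b then p else q) (\<lambda>x. ?joint (\<lambda>xs. f (x # xs)) k (n - k))))"
    unfolding bind_mixture_pmf by (subst bind_commute_pmf) (rule refl)
  also have "\<dots> = bind_pmf (bernoulli_pmf \<theta>) (\<lambda>b. bind_pmf (binomial_pmf n \<theta>) (\<lambda>k.
      ?joint f ((if b then 1 else 0) + k) (Suc n - ((if b then 1 else 0) + k))))"
  proof (intro bind_pmf_cong refl)
    fix b k assume "k \<in> set_pmf (binomial_pmf n \<theta>)"
    then have "Suc n - k = Suc (n - k)"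
      using unit by (auto simp: set_pmf_binomial_eq Suc_diff_le split: if_splits)
    then show "bind_pmf (if b then p else q) (\<lambda>x. ?joint (\<lambda>xs. f (x # xs)) k (n - k)) =
        ?joint f ((if b then 1 else 0) + k) (Suc n - ((if b then 1 else 0) + k))"
      using bind_map_append_replicate_pmf_left[of p f k "n - k" q]
        bind_map_append_replicate_pmf_right[where p = p and q = q and k = k and l = "n - k", OF Suc.prems]
      by (cases b) (simp_all del: replicate_pmf.simps)
  qed
  also have "\<dots> = bind_pmf (binomial_pmf (Suc n) \<theta>) (\<lambda>k. ?joint f k (Suc n - k))"
    using unit by (simp add: binomial_pmf_Suc bind_assoc_pmf bind_return_pmf)
  finally show ?case .
qed

lemma pmf_of_set_lists:
  assumes nodes: "finite V" "V \<noteq> {}"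
  shows "pmf_of_set {xs. set xs \<subseteq> V \<and> length xs = K} = replicate_pmf K (pmf_of_set V)"
proof (rule pmf_eqI)
  fix xs
  let ?L = "{xs. set xs \<subseteq> V \<and> length xs = K}"
  obtain v where "v \<in> V" using nodes by auto
  then have "replicate K v \<in> ?L" by auto
  then have "?L \<noteq> {}" by blast
  then have "pmf (pmf_of_set ?L) xs = of_bool (xs \<in> ?L) / card V ^ K"
    using nodes by (simp add: finite_lists_length_eq card_lists_length_eq indicator_def)
  also have "\<dots> = pmf (replicate_pmf K (pmf_of_set V)) xs"
  proof (induction K arbitrary: xs)
    case (Suc K)
    have inj: "inj (\<lambda>(x, xs). x # xs)"
      by (auto simp: inj_def)
    have replicate: "replicate_pmf (Suc K) (pmf_of_set V) =
        map_pmf (\<lambda>(x, xs). x # xs) (pair_pmf (pmf_of_set V) (replicate_pmf K (pmf_of_set V)))"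
      by (simp add: map_pmf_def pair_pmf_def bind_assoc_pmf bind_return_pmf)
    show ?case
    proof (cases xs)
      case Nil
      then show ?thesis by (auto simp: pmf_eq_0_set_pmf)
    next
      case (Cons y ys)
      then show ?thesis
        using nodes pmf_map_inj'[OF inj,
            of "pair_pmf (pmf_of_set V) (replicate_pmf K (pmf_of_set V))" "(y, ys)"]
        by (simp add: replicate pmf_pair Suc.IH[symmetric] indicator_def del: replicate_pmf.simps)
    qed
  qed (simp add: indicator_def)
  finally show "pmf (pmf_of_set ?L) xs = pmf (replicate_pmf K (pmf_of_set V)) xs" .
qed

lemma prob_replicate_pmf_subset:
  "measure_pmf.prob (replicate_pmf K p) {xs. set xs \<subseteq> C} = measure_pmf.prob p C ^ K"
proof (induction K)
  case (Suc K)
  have "measure_pmf.prob (replicate_pmf (Suc K) p) {xs. set xs \<subseteq> C} =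
      measure_pmf.expectation p (\<lambda>x. measure_pmf.prob (replicate_pmf K p) {xs. set (x # xs) \<subseteq> C})"
    by (simp add: prob_bind_pmf vimage_def flip: map_pmf_def)
  also have "\<dots> = measure_pmf.expectation p (\<lambda>x. indicator C x * measure_pmf.prob p C ^ K)"
    by (intro Bochner_Integration.integral_cong refl) (simp add: Suc.IH indicator_def)
  finally show ?case
    by simp
qed simp

lemma finite_set_pmf_replicate_pmf:
  "finite (set_pmf p) \<Longrightarrow> finite (set_pmf (replicate_pmf n p))"
  using finite_lists_length_eq[of "set_pmf p" n] by (simp add: set_replicate_pmf lists_eq_set)

lemma map_replicate_pmf:
  "map_pmf (map f) (replicate_pmf n p) = replicate_pmf n (map_pmf f p)"
proof (induction n)
  case (Suc n)
  show ?case by (simp add: map_bind_pmf bind_map_pmf flip: Suc.IH)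
qed simp

subsection \<open>Blockwise functions of tuples\<close>

definition blockwise :: "nat \<Rightarrow> 'a set \<Rightarrow> ('a list \<Rightarrow> real) \<Rightarrow> bool" where
  "blockwise K V g \<longleftrightarrow> (\<exists>\<Phi> \<kappa>. finite \<Phi> \<and> disjoint \<Phi> \<and> 0 \<le> \<kappa> \<and>
     (\<forall>xs. set xs \<subseteq> V \<and> length xs = K \<longrightarrow> g xs = \<kappa> * of_bool (\<exists>C\<in>\<Phi>. set xs \<subseteq> C)))"

lemma blockwise_subset:
  assumes "0 \<le> \<kappa>"
    and "\<And>xs. set xs \<subseteq> V \<Longrightarrow> length xs = K \<Longrightarrow> g xs = \<kappa> * of_bool (set xs \<subseteq> F)"
  shows "blockwise K V g"
  unfolding blockwise_def using assms by (intro exI[of _ "{F}"] exI[of _ \<kappa>]) auto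

lemma blockwise_fibres:
  assumes "finite V" "K > 0" "0 \<le> \<kappa>"
    and block_value: "\<And>xs. set xs \<subseteq> V \<Longrightarrow> length xs = K \<Longrightarrow>
      g xs = \<kappa> * of_bool (\<forall>i\<in>set xs. \<forall>j\<in>set xs. \<phi> i = \<phi> j)"
  shows "blockwise K V g"
proof -
  let ?\<Phi> = "(\<lambda>b. {i \<in> V. \<phi> i = b}) ` \<phi> ` V"
  have "(\<forall>i\<in>set xs. \<forall>j\<in>set xs. \<phi> i = \<phi> j) \<longleftrightarrow> (\<exists>C\<in>?\<Phi>. set xs \<subseteq> C)"
    if "set xs \<subseteq> V" "length xs = K" for xs
  proof
    have "hd xs \<in> set xs" using that \<open>K > 0\<close> by auto
    moreover assume "\<forall>i\<in>set xs. \<forall>j\<in>set xs. \<phi> i = \<phi> j"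
    ultimately have "set xs \<subseteq> {i \<in> V. \<phi> i = \<phi> (hd xs)}" "hd xs \<in> V"
      using that(1) by blast+
    then show "\<exists>C\<in>?\<Phi>. set xs \<subseteq> C"
      by (intro bexI[of _ "{i \<in> V. \<phi> i = \<phi> (hd xs)}"] imageI)
  next
    assume "\<exists>C\<in>?\<Phi>. set xs \<subseteq> C"
    then obtain b where "set xs \<subseteq> {i \<in> V. \<phi> i = b}" by blast
    then show "\<forall>i\<in>set xs. \<forall>j\<in>set xs. \<phi> i = \<phi> j" by auto
  qed
  then have "g xs = \<kappa> * of_bool (\<exists>C\<in>?\<Phi>. set xs \<subseteq> C)" if "set xs \<subseteq> V" "length xs = K" for xs
    using block_value that by simp
  moreover have "finite ?\<Phi>" "disjoint ?\<Phi>"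
    using \<open>finite V\<close> by (auto simp: disjoint_def)
  ultimately show ?thesis
    unfolding blockwise_def using \<open>0 \<le> \<kappa>\<close> by blast
qed

lemma prob_replicate_pmf_within_block:
  assumes blocks: "finite \<Phi>" "disjoint \<Phi>" and pos: "K > 0"
  shows "measure_pmf.prob (replicate_pmf K p) {xs. \<exists>C\<in>\<Phi>. set xs \<subseteq> C} =
    (\<Sum>C\<in>\<Phi>. measure_pmf.prob p C ^ K)"
proof -
  let ?A = "\<lambda>C. {xs. set xs \<subseteq> C \<and> xs \<noteq> []}"
  have nonempty: "AE xs in replicate_pmf K p. xs \<noteq> []"
    using pos by (intro AE_pmfI) (auto simp: set_replicate_pmf)
  have "measure_pmf.prob (replicate_pmf K p) {xs. \<exists>C\<in>\<Phi>. set xs \<subseteq> C} =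
      measure_pmf.prob (replicate_pmf K p) (\<Union>C\<in>\<Phi>. ?A C)"
    using nonempty by (intro measure_pmf.finite_measure_eq_AE) auto
  also have "\<dots> = (\<Sum>C\<in>\<Phi>. measure_pmf.prob (replicate_pmf K p) (?A C))"
  proof (intro measure_pmf.finite_measure_finite_Union blocks(1))
    show "disjoint_family_on ?A \<Phi>"
      using disjointD[OF blocks(2)] by (fastforce simp: disjoint_family_on_def neq_Nil_conv)
  qed simp
  also have "\<dots> = (\<Sum>C\<in>\<Phi>. measure_pmf.prob (replicate_pmf K p) {xs. set xs \<subseteq> C})"
    using nonempty by (intro sum.cong refl measure_pmf.finite_measure_eq_AE) auto
  finally show ?thesis
    by (simp add: prob_replicate_pmf_subset)
qed

lemma power_convex_combination:
  fixes x y :: real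
  assumes "\<theta> \<in> {0..1}" "0 \<le> x" "0 \<le> y"
  shows "(\<theta> * x + (1 - \<theta>) * y) ^ k \<le> \<theta> * x ^ k + (1 - \<theta>) * y ^ k"
proof -
  have "convex_on {0::real..} (\<lambda>x. x ^ k)"
    by (cases "even k") (auto intro: convex_power_odd convex_on_subset[OF convex_power_even])
  from convex_onD[OF this, of "1 - \<theta>" x y] show ?thesis
    using assms by (simp add: algebra_simps)
qed

lemma blockwise_expectation_mixture_le:
  assumes "blockwise K V g" "K > 0" "set_pmf p \<subseteq> V" "set_pmf q \<subseteq> V" and unit: "\<theta> \<in> {0..1}"
  shows "measure_pmf.expectation (replicate_pmf K (mixture_pmf \<theta> p q)) g \<le>
    \<theta> * measure_pmf.expectation (replicate_pmf K p) g +
    (1 - \<theta>) * measure_pmf.expectation (replicate_pmf K q) g"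
proof -
  obtain \<Phi> \<kappa> where blocks: "finite \<Phi>" "disjoint \<Phi>" and nonneg: "0 \<le> \<kappa>"
    and block_value: "\<And>xs. set xs \<subseteq> V \<Longrightarrow> length xs = K \<Longrightarrow> g xs = \<kappa> * of_bool (\<exists>C\<in>\<Phi>. set xs \<subseteq> C)"
    using \<open>blockwise K V g\<close> unfolding blockwise_def by blast
  have expectation: "measure_pmf.expectation (replicate_pmf K r) g =
      \<kappa> * (\<Sum>C\<in>\<Phi>. measure_pmf.prob r C ^ K)"
    if "set_pmf r \<subseteq> V" for r
  proof -
    have "measure_pmf.expectation (replicate_pmf K r) g =
        measure_pmf.expectation (replicate_pmf K r) (\<lambda>xs. \<kappa> * indicator {xs. \<exists>C\<in>\<Phi>. set xs \<subseteq> C} xs)"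
      using that by (intro integral_cong_AE AE_pmfI)
        (auto simp: set_replicate_pmf lists_eq_set block_value indicator_def)
    then show ?thesis
      using prob_replicate_pmf_within_block[OF blocks \<open>K > 0\<close>] by simp
  qed
  have "set_pmf (mixture_pmf \<theta> p q) \<subseteq> V"
    using assms by (auto simp: mixture_pmf_def split: if_splits)
  then have "measure_pmf.expectation (replicate_pmf K (mixture_pmf \<theta> p q)) g =
      \<kappa> * (\<Sum>C\<in>\<Phi>. (\<theta> * measure_pmf.prob p C + (1 - \<theta>) * measure_pmf.prob q C) ^ K)"
    by (simp add: expectation prob_mixture_pmf[OF unit])
  also have "\<dots> \<le> \<kappa> * (\<Sum>C\<in>\<Phi>. \<theta> * measure_pmf.prob p C ^ K + (1 - \<theta>) * measure_pmf.prob q C ^ K)"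
    using nonneg unit by (intro mult_left_mono sum_mono power_convex_combination) simp_all
  finally show ?thesis
    using assms
    by (simp add: expectation sum.distrib distrib_left mult.left_commute flip: sum_distrib_left)
qed

subsection \<open>Hyperedges violated by a set of assignments\<close>

fun violated :: "model \<Rightarrow> bool list \<Rightarrow> nat list \<Rightarrow> bool" where
  "violated IndSet a ys = (ys ! 0 = 1 \<and> ys ! 1 = 1)"
| "violated (KSAT K) a ys = (ys = map of_bool a)"
| "violated (NAEKSAT K) a ys = (ys = map of_bool a \<or> ys = map (\<lambda>b. of_bool (\<not> b)) a)"
| "violated _ a ys = (ys ! 0 = ys ! 1)"

definition violated_edges :: "model \<Rightarrow> (nat \<Rightarrow> nat) set \<Rightarrow> edge set" where
  "violated_edges m X = {e. \<forall>x\<in>X. violated m (snd e) (map x (fst e))}"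

definition violation_prob :: "model \<Rightarrow> (nat \<Rightarrow> nat) set \<Rightarrow> nat list \<Rightarrow> real" where
  "violation_prob m X xs = measure_pmf.prob (sign_pmf m) {a. \<forall>x\<in>X. violated m a (map x xs)}"

lemma eq_map_of_bool_iff:
  assumes "set ys \<subseteq> {..<2::nat}"
  shows "ys = map of_bool a \<longleftrightarrow> a = map (\<lambda>v. v = 1) ys"
    and "ys = map (\<lambda>b. of_bool (\<not> b)) a \<longleftrightarrow> a = map (\<lambda>v. v \<noteq> 1) ys"
proof -
  have binary: "ys ! i = 0 \<or> ys ! i = 1" if "i < length ys" for i
    using nth_mem[OF that] assms by (auto simp: less_2_cases_iff)
  then show "ys = map of_bool a \<longleftrightarrow> a = map (\<lambda>v. v = 1) ys"
    and "ys = map (\<lambda>b. of_bool (\<not> b)) a \<longleftrightarrow> a = map (\<lambda>v. v \<noteq> 1) ys"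
    unfolding list_eq_iff_nth_eq by (auto simp del: One_nat_def dest: binary)
qed

lemma finite_bool_lists: "finite {a :: bool list. length a = K}"
  and nonempty_bool_lists: "{a :: bool list. length a = K} \<noteq> {}"
  and card_bool_lists: "card {a :: bool list. length a = K} = 2 ^ K"
  using finite_lists_length_eq[of "UNIV :: bool set" K] card_lists_length_eq[of "UNIV :: bool set" K]
    Ex_list_of_length[of K] by auto

lemma prob_uniform_bool_lists:
  assumes "S \<subseteq> {a :: bool list. length a = K}"
  shows "measure_pmf.prob (pmf_of_set {a. length a = K}) S = card S / 2 ^ K"
  using assms measure_pmf_of_set[OF nonempty_bool_lists finite_bool_lists, of K S]
  by (simp add: card_bool_lists inf_absorb2)

lemma blockwise_violation_prob_KSAT:
  assumes "X \<noteq> {}" and binary: "\<forall>x\<in>X. \<forall>i\<in>V. x i < 2"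
  shows "blockwise K V (violation_prob (KSAT K) X)"
proof -
  obtain x0 where "x0 \<in> X" using \<open>X \<noteq> {}\<close> by auto
  let ?F = "{i. \<forall>x\<in>X. (x i = 1) = (x0 i = 1)}"
  show ?thesis
  proof (rule blockwise_subset)
    fix xs assume tuple: "set xs \<subseteq> V" "length xs = K"
    define \<beta> where "\<beta> = (\<lambda>x :: nat \<Rightarrow> nat. map (\<lambda>i. x i = 1) xs)"
    have spins: "set (map x xs) \<subseteq> {..<2}" if "x \<in> X" for x
      using binary tuple(1) that by auto
    have violated_iff: "violated (KSAT K) a (map x xs) \<longleftrightarrow> a = \<beta> x" if "x \<in> X" for a x
      by (simp only: violated.simps eq_map_of_bool_iff(1)[OF spins[OF that]] \<beta>_def map_map comp_def)
    have frozen_iff: "set xs \<subseteq> ?F \<longleftrightarrow> (\<forall>x\<in>X. \<beta> x = \<beta> x0)"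
      by (auto simp: \<beta>_def)
    have "(\<forall>x\<in>X. violated (KSAT K) a (map x xs)) \<longleftrightarrow> a = \<beta> x0 \<and> set xs \<subseteq> ?F" for a
      using violated_iff \<open>x0 \<in> X\<close> unfolding frozen_iff by metis
    then show "violation_prob (KSAT K) X xs = 1 / 2 ^ K * of_bool (set xs \<subseteq> ?F)"
      using tuple(2) unfolding violation_prob_def
      by (simp add: sign_pmf_def prob_uniform_bool_lists \<beta>_def Collect_conv_if del: violated.simps)
  qed simp
qed

lemma map_eq_or_map_Not_eq_iff:
  "map f xs = map g xs \<or> map f xs = map Not (map g xs) \<longleftrightarrow>
    (\<forall>i\<in>set xs. \<forall>j\<in>set xs. (f i = g i) = (f j = g j))"
  unfolding map_map map_eq_conv comp_def by blast

lemma blockwise_violation_prob_NAEKSAT: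
  assumes "X \<noteq> {}" and binary: "\<forall>x\<in>X. \<forall>i\<in>V. x i < 2" and "finite V" "K > 0"
  shows "blockwise K V (violation_prob (NAEKSAT K) X)"
proof -
  obtain x0 where "x0 \<in> X" using \<open>X \<noteq> {}\<close> by auto
  define \<phi> where "\<phi> = (\<lambda>i. \<lambda>x\<in>X. (x i = 1) = (x0 i = 1))"
  show ?thesis
  proof (rule blockwise_fibres[OF \<open>finite V\<close> \<open>K > 0\<close>])
    fix xs assume tuple: "set xs \<subseteq> V" "length xs = K"
    define \<beta> where "\<beta> = (\<lambda>x :: nat \<Rightarrow> nat. map (\<lambda>i. x i = 1) xs)"
    have spins: "set (map x xs) \<subseteq> {..<2}" if "x \<in> X" for x
      using binary tuple(1) that by auto
    have violated_iff: "violated (NAEKSAT K) a (map x xs) \<longleftrightarrow> a = \<beta> x \<or> a = map Not (\<beta> x)"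
      if "x \<in> X" for a x
      by (simp only: violated.simps eq_map_of_bool_iff[OF spins[OF that]] \<beta>_def map_map comp_def)
    define homogeneous where "homogeneous \<longleftrightarrow> (\<forall>i\<in>set xs. \<forall>j\<in>set xs. \<phi> i = \<phi> j)"
    have homogeneous_iff: "homogeneous \<longleftrightarrow> (\<forall>x\<in>X. \<beta> x = \<beta> x0 \<or> \<beta> x = map Not (\<beta> x0))"
      unfolding \<beta>_def map_eq_or_map_Not_eq_iff
      by (auto simp: homogeneous_def \<phi>_def fun_eq_iff restrict_def)
    have "map Not (map Not b) = b" for b by (simp add: comp_def)
    then have "(\<forall>x\<in>X. violated (NAEKSAT K) a (map x xs)) \<longleftrightarrow>
        (a = \<beta> x0 \<or> a = map Not (\<beta> x0)) \<and> homogeneous" for a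
      using violated_iff \<open>x0 \<in> X\<close> unfolding homogeneous_iff by metis
    then have violating: "{a. \<forall>x\<in>X. violated (NAEKSAT K) a (map x xs)} =
        (if homogeneous then {\<beta> x0, map Not (\<beta> x0)} else {})"
      by (auto simp del: violated.simps)
    have "length (\<beta> x0) = K"
      using tuple(2) by (simp add: \<beta>_def)
    moreover from this have "\<beta> x0 \<noteq> map Not (\<beta> x0)"
      using \<open>K > 0\<close> by (cases "\<beta> x0") auto
    ultimately show "violation_prob (NAEKSAT K) X xs =
        2 / 2 ^ K * of_bool (\<forall>i\<in>set xs. \<forall>j\<in>set xs. \<phi> i = \<phi> j)"
      unfolding violation_prob_def violating homogeneous_def[symmetric]
      by (simp add: sign_pmf_def prob_uniform_bool_lists)
  qed simp
qed

lemma violation_prob_eq_of_bool: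
  assumes "sign_pmf m = return_pmf a"
  shows "violation_prob m X xs = of_bool (\<forall>x\<in>X. violated m a (map x xs))"
  using assms by (simp add: violation_prob_def indicator_def)

lemma blockwise_violation_prob_IndSet: "blockwise 2 V (violation_prob IndSet X)"
proof (rule blockwise_subset)
  fix xs :: "nat list" assume "length xs = 2"
  then obtain i j where xs: "xs = [i, j]" by (auto simp: numeral_2_eq_2 length_Suc_conv)
  show "violation_prob IndSet X xs = 1 * of_bool (set xs \<subseteq> {i. \<forall>x\<in>X. x i = 1})"
    by (auto simp: xs violation_prob_eq_of_bool sign_pmf_def)
qed simp

lemma blockwise_violation_prob_monochromatic:
  assumes "finite V" and model: "m = MaxCut \<or> m = Ising b B \<or> m = Coloring q"
  shows "blockwise 2 V (violation_prob m X)"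
proof (rule blockwise_fibres[OF \<open>finite V\<close>])
  let ?\<phi> = "\<lambda>i. \<lambda>x\<in>X. x i"
  fix xs :: "nat list" assume "length xs = 2"
  then obtain i j where xs: "xs = [i, j]" by (auto simp: numeral_2_eq_2 length_Suc_conv)
  have "violation_prob m X xs = of_bool (\<forall>x\<in>X. x i = x j)"
    using model by (elim disjE) (simp_all add: xs violation_prob_eq_of_bool sign_pmf_def)
  also have "(\<forall>x\<in>X. x i = x j) \<longleftrightarrow> (\<forall>i\<in>set xs. \<forall>j\<in>set xs. ?\<phi> i = ?\<phi> j)"
    by (auto simp: xs fun_eq_iff restrict_def)
  finally show "violation_prob m X xs = 1 * of_bool (\<forall>i\<in>set xs. \<forall>j\<in>set xs. ?\<phi> i = ?\<phi> j)"
    by simp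
qed simp_all

lemma arity_pos: "valid_model m \<Longrightarrow> arity m > 0"
  by (cases m) auto

lemma blockwise_violation_prob:
  assumes valid: "valid_model m" and "finite V" and spins: "\<forall>x\<in>X. \<forall>i\<in>V. x i < nstates m"
  shows "blockwise (arity m) V (violation_prob m X)"
proof (cases "X = {}")
  case True
  then show ?thesis
    by (intro blockwise_subset[of 1 _ _ _ V]) (simp_all add: violation_prob_def)
next
  case False
  show ?thesis
  proof (cases m)
    case IndSet
    then show ?thesis by (simp add: blockwise_violation_prob_IndSet)
  next
    case (KSAT K)
    then show ?thesis using False spins by (simp add: blockwise_violation_prob_KSAT)
  next
    case (NAEKSAT K)
    then show ?thesis using False spins valid \<open>finite V\<close> by (simp add: blockwise_violation_prob_NAEKSAT)
  qed (use \<open>finite V\<close> in \<open>simp_all add: blockwise_violation_prob_monochromatic\<close>)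
qed

subsection \<open>Ground state energies\<close>

abbreviation assignments :: "model \<Rightarrow> nat set \<Rightarrow> (nat \<Rightarrow> nat) set" where
  "assignments m V \<equiv> PiE V (\<lambda>_. {..<nstates m})"

lemma nstates_pos: "valid_model m \<Longrightarrow> nstates m > 0"
  by (cases m) auto

lemma finite_nonempty_assignments:
  assumes "valid_model m" "finite V"
  shows "finite (assignments m V)" "assignments m V \<noteq> {}"
  using assms nstates_pos[of m] by (auto simp: PiE_eq_empty_iff lessThan_empty_iff intro!: finite_PiE)

lemma le_HG_iff:
  assumes "valid_model m" "finite V"
  shows "t \<le> HG m V E \<longleftrightarrow> (\<exists>x \<in> assignments m V. t \<le> Hx m V E x)"
  unfolding HG_def using finite_nonempty_assignments[OF assms] by (subst Max_ge_iff) auto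

lemma Hx_le_HG:
  assumes "valid_model m" "finite V" "x \<in> assignments m V"
  shows "Hx m V E x \<le> HG m V E"
  using assms le_HG_iff by blast

lemma HG_attained:
  assumes "valid_model m" "finite V"
  obtains x where "x \<in> assignments m V" "HG m V E = Hx m V E x"
  using le_HG_iff[OF assms, of "HG m V E" E] Hx_le_HG[OF assms] by (metis order.antisym order.refl)

lemma HG_cong_mset:
  assumes "mset E = mset E'"
  shows "HG m V E = HG m V E'"
proof -
  have "(\<Sum>e\<leftarrow>E. g e) = (\<Sum>e\<leftarrow>E'. g e)" for g :: "edge \<Rightarrow> ereal"
    by (simp flip: sum_mset_sum_list add: assms)
  then show ?thesis by (simp add: HG_def Hx_def[abs_def])
qed

lemma Hx_Cons: "Hx m V (e # E) x = Hx m V E x + hedge m (snd e) (map x (fst e))"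
  by (simp add: Hx_def ac_simps)

fun violated_value :: "model \<Rightarrow> ereal" where
  "violated_value IndSet = - \<infinity>"
| "violated_value (Ising \<beta> B) = ereal (- \<beta>)"
| "violated_value _ = 0"

fun satisfied_value :: "model \<Rightarrow> ereal" where
  "satisfied_value IndSet = 0"
| "satisfied_value (Ising \<beta> B) = ereal \<beta>"
| "satisfied_value _ = 1"

lemma hedge_eq: "hedge m a ys = (if violated m a ys then violated_value m else satisfied_value m)"
  by (cases m) auto

lemma violated_value_le_hedge: "valid_model m \<Longrightarrow> violated_value m \<le> hedge m a ys"
  by (cases m) auto

lemma superlevel_HG_Cons_cases:
  assumes valid: "valid_model m" and finite_V: "finite V"
  obtains (all) "{e. t \<le> HG m V (e # E)} = UNIV"
  | (not_violated) X where "X \<subseteq> assignments m V"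
      "{e. t \<le> HG m V (e # E)} = - violated_edges m X"
proof (cases "\<exists>x\<in>assignments m V. t \<le> Hx m V E x + violated_value m")
  case True
  then obtain x where witness: "x \<in> assignments m V" "t \<le> Hx m V E x + violated_value m" by blast
  have "t \<le> Hx m V (e # E) x" for e
    using witness(2) add_left_mono[OF violated_value_le_hedge[OF valid]]
    unfolding Hx_Cons by (rule order.trans)
  then have "t \<le> HG m V (e # E)" for e
    using witness(1) le_HG_iff[OF valid finite_V] by blast
  then show ?thesis by (intro all) simp
next
  case False
  let ?X = "{x \<in> assignments m V. t \<le> Hx m V E x + satisfied_value m}"
  show ?thesis
  proof (rule not_violated)
    show "?X \<subseteq> assignments m V" by simp
    show "{e. t \<le> HG m V (e # E)} = - violated_edges m ?X"
      using False by (auto simp: le_HG_iff[OF valid finite_V] Hx_Cons hedge_eq violated_edges_def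
          split: if_splits)
  qed
qed

definition wf_graph :: "model \<Rightarrow> nat set \<Rightarrow> edge list \<Rightarrow> bool" where
  "wf_graph m V E \<longleftrightarrow> (\<forall>e\<in>set E. set (fst e) \<subseteq> V \<and> length (fst e) = arity m)"

lemma Hx_cong:
  assumes "wf_graph m V E" "\<And>i. i \<in> V \<Longrightarrow> x i = y i"
  shows "Hx m V E x = Hx m V E y"
proof -
  have "map x (fst e) = map y (fst e)" if "e \<in> set E" for e
    using assms that by (auto simp: wf_graph_def)
  then have "(\<Sum>e\<leftarrow>E. hedge m (snd e) (map x (fst e))) = (\<Sum>e\<leftarrow>E. hedge m (snd e) (map y (fst e)))"
    by (intro arg_cong[where f = sum_list] map_cong refl) (simp only:)
  moreover have "(\<Sum>i\<in>V. hnode m (x i)) = (\<Sum>i\<in>V. hnode m (y i))"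
    by (intro sum.cong) (simp_all add: assms(2))
  ultimately show ?thesis by (simp add: Hx_def)
qed

lemma Hx_disjoint_union:
  assumes "finite V1" "finite V2" "V1 \<inter> V2 = {}"
  shows "Hx m (V1 \<union> V2) (E1 @ E2) x = Hx m V1 E1 x + Hx m V2 E2 x"
  using assms by (simp add: Hx_def sum.union_disjoint ac_simps)

lemma HG_disjoint_union:
  assumes valid: "valid_model m" and nodes: "finite V1" "finite V2" "V1 \<inter> V2 = {}"
    and wf: "wf_graph m V1 E1" "wf_graph m V2 E2"
  shows "HG m (V1 \<union> V2) (E1 @ E2) = HG m V1 E1 + HG m V2 E2"
proof -
  note Hx_union = Hx_disjoint_union[OF nodes, of m E1 E2]
  show ?thesis
  proof (rule antisym)
    obtain x where maximizer: "x \<in> assignments m (V1 \<union> V2)"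
      "HG m (V1 \<union> V2) (E1 @ E2) = Hx m (V1 \<union> V2) (E1 @ E2) x"
      using HG_attained[OF valid] nodes by (metis finite_Un)
    have restricted: "Hx m W E x \<le> HG m W E" if "W \<subseteq> V1 \<union> V2" "wf_graph m W E" for W E
    proof -
      have "Hx m W E x = Hx m W E (restrict x W)"
        using that(2) by (rule Hx_cong) simp
      also have "\<dots> \<le> HG m W E"
        using maximizer(1) that(1) nodes by (intro Hx_le_HG[OF valid]) (auto intro: finite_subset)
      finally show ?thesis .
    qed
    show "HG m (V1 \<union> V2) (E1 @ E2) \<le> HG m V1 E1 + HG m V2 E2"
      unfolding maximizer(2) Hx_union using wf by (intro add_mono restricted) auto
  next
    obtain x1 where maximizer1: "x1 \<in> assignments m V1" "HG m V1 E1 = Hx m V1 E1 x1"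
      using HG_attained[OF valid nodes(1)] .
    obtain x2 where maximizer2: "x2 \<in> assignments m V2" "HG m V2 E2 = Hx m V2 E2 x2"
      using HG_attained[OF valid nodes(2)] .
    define x where "x = (\<lambda>i. if i \<in> V1 then x1 i else x2 i)"
    have "Hx m V1 E1 x1 = Hx m V1 E1 x"
      by (rule Hx_cong[OF wf(1)]) (simp add: x_def)
    moreover have "Hx m V2 E2 x2 = Hx m V2 E2 x"
      by (rule Hx_cong[OF wf(2)]) (use nodes in \<open>auto simp: x_def\<close>)
    moreover have "x \<in> assignments m (V1 \<union> V2)"
      using maximizer1(1) maximizer2(1) by (auto simp: x_def PiE_iff extensional_def)
    ultimately show "HG m V1 E1 + HG m V2 E2 \<le> HG m (V1 \<union> V2) (E1 @ E2)"
      using Hx_le_HG[OF valid _ \<open>x \<in> assignments m (V1 \<union> V2)\<close>, of "E1 @ E2"] nodes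
      by (simp add: maximizer1(2) maximizer2(2) Hx_union)
  qed
qed

lemma abs_sum_list_eq_infinity_iff:
  fixes f :: "'a \<Rightarrow> ereal"
  shows "\<bar>\<Sum>x\<leftarrow>xs. f x\<bar> = \<infinity> \<longleftrightarrow> (\<exists>x\<in>set xs. \<bar>f x\<bar> = \<infinity>)"
proof (induction xs)
  case (Cons x xs)
  then show ?case by (cases "f x"; cases "\<Sum>x\<leftarrow>xs. f x") auto
qed simp

lemma sum_list_eq_PInfty_iff:
  fixes f :: "'a \<Rightarrow> ereal"
  shows "(\<Sum>x\<leftarrow>xs. f x) = \<infinity> \<longleftrightarrow> (\<exists>x\<in>set xs. f x = \<infinity>)"
  by (induction xs) auto

lemma abs_hnode_neq_infinity: "\<bar>hnode m v\<bar> \<noteq> \<infinity>"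
  by (cases m) auto

lemma HG_neq_PInfty:
  assumes "valid_model m" "finite V"
  shows "HG m V E \<noteq> \<infinity>"
proof -
  have "hnode m v \<noteq> \<infinity>" "hedge m a ys \<noteq> \<infinity>" for v a ys
    by (cases m; auto)+
  then have "Hx m V E x \<noteq> \<infinity>" for x
    by (simp add: Hx_def sum_Pinfty sum_list_eq_PInfty_iff)
  then show ?thesis
    using HG_attained[OF assms] by metis
qed

lemma abs_HG_neq_infinity:
  assumes valid: "valid_model m" and finite_V: "finite V" and wf: "wf_graph m V E"
  shows "\<bar>HG m V E\<bar> \<noteq> \<infinity>"
proof -
  define x where "x = (\<lambda>i\<in>V. 0 :: nat)"
  have "\<bar>hedge m (snd e) (map x (fst e))\<bar> \<noteq> \<infinity>" if "e \<in> set E" for e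
  proof (cases m)
    case IndSet
    then have "length (fst e) = 2" "set (fst e) \<subseteq> V" using wf that by (auto simp: wf_graph_def)
    then have "fst e ! 0 \<in> V" "0 < length (fst e)" using nth_mem[of 0 "fst e"] by auto
    then show ?thesis using IndSet by (simp add: x_def)
  qed auto
  then have "\<bar>\<Sum>e\<leftarrow>E. hedge m (snd e) (map x (fst e))\<bar> \<noteq> \<infinity>"
    by (simp add: abs_sum_list_eq_infinity_iff)
  moreover have "\<bar>\<Sum>i\<in>V. hnode m (x i)\<bar> \<noteq> \<infinity>"
    by (simp add: sum_Inf abs_hnode_neq_infinity)
  ultimately have "\<bar>Hx m V E x\<bar> \<noteq> \<infinity>"
    by (auto simp: Hx_def)
  moreover have "Hx m V E x \<le> HG m V E"
    by (rule Hx_le_HG[OF valid finite_V]) (use nstates_pos[OF valid] in \<open>auto simp: x_def\<close>)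
  ultimately show ?thesis
    using HG_neq_PInfty[OF valid finite_V, of E] by auto
qed

lemma HG_image:
  assumes inj: "inj_on f V" and wf: "wf_graph m V E"
  shows "HG m (f ` V) (map (apfst (map f)) E) = HG m V E"
proof -
  have Hx_image: "Hx m (f ` V) (map (apfst (map f)) E) x = Hx m V E (x \<circ> f)" for x
    using inj by (simp add: Hx_def sum.reindex comp_def)
  have "Hx m (f ` V) (map (apfst (map f)) E) ` assignments m (f ` V) = Hx m V E ` assignments m V"
  proof (intro equalityI subsetI)
    fix h assume "h \<in> Hx m (f ` V) (map (apfst (map f)) E) ` assignments m (f ` V)"
    then obtain x where preimage: "x \<in> assignments m (f ` V)" "h = Hx m V E (x \<circ> f)"
      by (auto simp: Hx_image)
    have "h = Hx m V E (restrict (x \<circ> f) V)"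
      unfolding preimage(2) by (rule Hx_cong[OF wf]) simp
    moreover have "restrict (x \<circ> f) V \<in> assignments m V" using preimage(1) by (auto simp: PiE_iff)
    ultimately show "h \<in> Hx m V E ` assignments m V" by blast
  next
    fix h assume "h \<in> Hx m V E ` assignments m V"
    then obtain y where preimage: "y \<in> assignments m V" "h = Hx m V E y" by auto
    define x where "x = restrict (y \<circ> inv_into V f) (f ` V)"
    have "h = Hx m V E (x \<circ> f)"
      unfolding preimage(2) by (rule Hx_cong[OF wf]) (simp add: x_def inj)
    moreover have "x \<in> assignments m (f ` V)" using preimage(1) inj by (auto simp: x_def PiE_iff)
    ultimately show "h \<in> Hx m (f ` V) (map (apfst (map f)) E) ` assignments m (f ` V)"
      unfolding Hx_image[symmetric] by blast
  qed
  then show ?thesis by (simp add: HG_def)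
qed

lemma HG_le_length:
  assumes csp: "is_csp m" and "valid_model m" "finite V"
  shows "HG m V E \<le> ereal (real (length E))"
proof -
  have "hedge m a ys \<le> 1" for a ys
    using csp by (cases m) (auto simp: is_csp_def)
  then have "(\<Sum>e\<leftarrow>E. hedge m (snd e) (map x (fst e))) \<le> (\<Sum>e\<leftarrow>E. 1)" for x
    by (intro sum_list_mono)
  moreover have "(\<Sum>e\<leftarrow>E. 1) = ereal (real (length E))"
    by (induction E) (simp_all add: one_ereal_def)
  moreover have "hnode m v = 0" for v
    using csp by (cases m) (auto simp: is_csp_def)
  ultimately have "Hx m V E x \<le> ereal (real (length E))" for x
    by (simp add: Hx_def)
  then show ?thesis
    using HG_attained[OF assms(2,3)] by metis
qed

subsection \<open>Random hypergraphs\<close>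

lemma edge_pmf_eq:
  assumes "finite V" "V \<noteq> {}"
  shows "edge_pmf m V = pair_pmf (replicate_pmf (arity m) (pmf_of_set V)) (sign_pmf m)"
  using pmf_of_set_lists[OF assms] by (simp add: edge_pmf_def)

lemma rgraph_eq_replicate_pmf: "rgraph m V n = replicate_pmf n (edge_pmf m V)"
  by (induction n) (simp_all add: map_pmf_def)

lemma finite_set_pmf_rgraph:
  assumes "finite V" "V \<noteq> {}"
  shows "finite (set_pmf (rgraph m V n))"
proof -
  have "finite (set_pmf (sign_pmf m))"
    by (cases m) (simp_all add: sign_pmf_def finite_bool_lists
        set_pmf_of_set[OF nonempty_bool_lists finite_bool_lists])
  then show ?thesis
    unfolding rgraph_eq_replicate_pmf edge_pmf_eq[OF assms] using assms
    by (intro finite_set_pmf_replicate_pmf) (simp add: finite_set_pmf_replicate_pmf)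
qed

lemma set_pmf_rgraphD:
  assumes nodes: "finite V" "V \<noteq> {}" and graph: "E \<in> set_pmf (rgraph m V n)"
  shows "wf_graph m V E" "length E = n"
proof -
  have "set (fst e) \<subseteq> V \<and> length (fst e) = arity m" if "e \<in> set_pmf (edge_pmf m V)" for e
    using that nodes by (auto simp: edge_pmf_eq[OF nodes] set_replicate_pmf lists_eq_set)
  moreover have "set E \<subseteq> set_pmf (edge_pmf m V)" and "length E = n"
    using graph by (auto simp: rgraph_eq_replicate_pmf set_replicate_pmf)
  ultimately show "wf_graph m V E" "length E = n"
    by (auto simp: wf_graph_def)
qed

lemma edge_pmf_image:
  assumes inj: "inj_on f V" and nodes: "finite V" "V \<noteq> {}"
  shows "edge_pmf m (f ` V) = map_pmf (apfst (map f)) (edge_pmf m V)"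
proof -
  have "edge_pmf m (f ` V) =
      pair_pmf (map_pmf (map f) (replicate_pmf (arity m) (pmf_of_set V))) (sign_pmf m)"
    using nodes map_pmf_of_set_inj[OF inj] by (simp add: edge_pmf_eq map_replicate_pmf)
  then show ?thesis
    by (simp add: pair_map_pmf1 edge_pmf_eq[OF nodes])
qed

lemma rgraph_image:
  assumes "inj_on f V" "finite V" "V \<noteq> {}"
  shows "rgraph m (f ` V) n = map_pmf (map (apfst (map f))) (rgraph m V n)"
  by (simp add: rgraph_eq_replicate_pmf map_replicate_pmf edge_pmf_image[OF assms])

lemma EH_image:
  assumes inj: "inj_on f V" and nodes: "finite V" "V \<noteq> {}"
  shows "EH m (f ` V) D = EH m V D"
proof -
  have "bind_pmf D (rgraph m (f ` V)) = map_pmf (map (apfst (map f))) (bind_pmf D (rgraph m V))"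
    by (simp add: rgraph_image[OF inj nodes, abs_def] map_bind_pmf)
  then have "EH m (f ` V) D = measure_pmf.expectation (bind_pmf D (rgraph m V))
      (\<lambda>E. real_of_ereal (HG m (f ` V) (map (apfst (map f)) E)))"
    by (simp add: EH_def)
  also have "\<dots> = EH m V D"
    unfolding EH_def
    by (intro integral_cong_AE AE_pmfI)
      (auto dest!: set_pmf_rgraphD(1)[OF nodes] simp: HG_image[OF inj])
  finally show ?thesis .
qed

lemma prob_edge_pmf_violated_edges:
  assumes "finite W" "W \<noteq> {}"
  shows "measure_pmf.prob (edge_pmf m W) (violated_edges m X) =
    measure_pmf.expectation (replicate_pmf (arity m) (pmf_of_set W)) (violation_prob m X)"
  by (simp add: edge_pmf_eq[OF assms] pair_pmf_def prob_bind_pmf violated_edges_def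
      violation_prob_def[abs_def] indicator_def[abs_def] vimage_def flip: map_pmf_def)

subsection \<open>Splitting the node set\<close>

locale node_split =
  fixes m :: model and V1 V2 :: "nat set"
  assumes valid: "valid_model m"
    and finite_nodes: "finite V1" "finite V2"
    and nonempty_nodes: "V1 \<noteq> {}" "V2 \<noteq> {}"
    and disjoint_nodes: "V1 \<inter> V2 = {}"
begin

abbreviation V :: "nat set" where
  "V \<equiv> V1 \<union> V2"

abbreviation \<theta> :: real where
  "\<theta> \<equiv> card V1 / card V"

abbreviation mixed_edge_pmf :: "edge pmf" where
  "mixed_edge_pmf \<equiv> mixture_pmf \<theta> (edge_pmf m V1) (edge_pmf m V2)"

definition split_rgraph :: "nat \<Rightarrow> (edge list \<times> edge list) pmf" where
  "split_rgraph n = bind_pmf (binomial_pmf n \<theta>) (\<lambda>k. pair_pmf (rgraph m V1 k) (rgraph m V2 (n - k)))"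

lemma \<theta>_in_unit_interval: "\<theta> \<in> {0..1}"
  using finite_nodes card_mono[of V V1] by (auto simp: divide_le_eq_1)

lemma finite_V: "finite V" and nonempty_V: "V \<noteq> {}"
  using finite_nodes nonempty_nodes by auto

lemma prob_violated_edges_le_mixed:
  assumes "X \<subseteq> assignments m V"
  shows "measure_pmf.prob (edge_pmf m V) (violated_edges m X) \<le>
    measure_pmf.prob mixed_edge_pmf (violated_edges m X)"
proof -
  have "\<forall>x\<in>X. \<forall>i\<in>V. x i < nstates m"
    using assms by auto
  then have "blockwise (arity m) V (violation_prob m X)"
    by (rule blockwise_violation_prob[OF valid finite_V])
  from blockwise_expectation_mixture_le[OF this arity_pos[OF valid] _ _ \<theta>_in_unit_interval]
  show ?thesis
    using finite_nodes nonempty_nodes finite_V nonempty_V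
    by (simp add: prob_mixture_pmf[OF \<theta>_in_unit_interval] prob_edge_pmf_violated_edges
        pmf_of_set_Un[OF finite_nodes nonempty_nodes disjoint_nodes])
qed

lemma stoch_le_HG_Cons:
  "stoch_le (map_pmf (\<lambda>e. HG m V (e # E)) mixed_edge_pmf)
    (map_pmf (\<lambda>e. HG m V (e # E)) (edge_pmf m V))"
  unfolding stoch_le_def
proof
  fix t
  have "measure_pmf.prob mixed_edge_pmf {e. t \<le> HG m V (e # E)} \<le>
      measure_pmf.prob (edge_pmf m V) {e. t \<le> HG m V (e # E)}"
    using valid finite_V
  proof (cases rule: superlevel_HG_Cons_cases[of m V t E])
    case (not_violated X)
    then show ?thesis
      using prob_violated_edges_le_mixed[OF not_violated(1)]
      by (simp add: Compl_eq_Diff_UNIV measure_pmf.prob_compl[unfolded space_measure_pmf])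
  qed simp
  then show "measure_pmf.prob (map_pmf (\<lambda>e. HG m V (e # E)) mixed_edge_pmf) {t..} \<le>
      measure_pmf.prob (map_pmf (\<lambda>e. HG m V (e # E)) (edge_pmf m V)) {t..}"
    by (simp add: vimage_def)
qed

lemma stoch_le_HG_split_rgraph:
  "stoch_le (map_pmf (\<lambda>(E1, E2). HG m V (E1 @ E2)) (split_rgraph n))
    (map_pmf (HG m V) (rgraph m V n))"
proof -
  have "map_pmf (\<lambda>(E1, E2). HG m V (E1 @ E2)) (split_rgraph n) =
      map_pmf (HG m V) (replicate_pmf n mixed_edge_pmf)"
    by (simp add: map_replicate_pmf_mixture_pmf[OF \<theta>_in_unit_interval HG_cong_mset] split_rgraph_def
        map_bind_pmf rgraph_eq_replicate_pmf)
  moreover have "stoch_le (map_pmf (HG m V) (replicate_pmf n mixed_edge_pmf))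
      (map_pmf (HG m V) (rgraph m V n))"
    unfolding rgraph_eq_replicate_pmf
    by (rule stoch_le_map_replicate_pmf[OF HG_cong_mset stoch_le_HG_Cons])
  ultimately show ?thesis by simp
qed

lemma finite_set_pmf_split_rgraph: "finite (set_pmf (split_rgraph n))"
  using finite_set_pmf_binomial_pmf[OF \<theta>_in_unit_interval, of n] finite_nodes nonempty_nodes
  by (simp add: split_rgraph_def finite_set_pmf_rgraph)

lemma set_pmf_split_rgraphD:
  assumes "(E1, E2) \<in> set_pmf (split_rgraph n)"
  shows "wf_graph m V1 E1" "wf_graph m V2 E2" "wf_graph m V (E1 @ E2)"
proof -
  show "wf_graph m V1 E1" "wf_graph m V2 E2"
    using assms set_pmf_rgraphD(1) finite_nodes nonempty_nodes by (auto simp: split_rgraph_def)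
  then show "wf_graph m V (E1 @ E2)" by (auto simp: wf_graph_def)
qed

lemma EH_add_eq_expectation_split_rgraph:
  "EH m V1 (binomial_pmf n \<theta>) + EH m V2 (map_pmf (\<lambda>k. n - k) (binomial_pmf n \<theta>)) =
    measure_pmf.expectation (split_rgraph n) (\<lambda>(E1, E2). real_of_ereal (HG m V (E1 @ E2)))"
proof -
  let ?h = "\<lambda>W E. real_of_ereal (HG m W E)"
  have "EH m V1 (binomial_pmf n \<theta>) = measure_pmf.expectation (map_pmf fst (split_rgraph n)) (?h V1)"
    by (simp add: EH_def split_rgraph_def map_bind_pmf map_fst_pair_pmf del: integral_map_pmf)
  moreover have "EH m V2 (map_pmf (\<lambda>k. n - k) (binomial_pmf n \<theta>)) =
      measure_pmf.expectation (map_pmf snd (split_rgraph n)) (?h V2)"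
    by (simp add: EH_def split_rgraph_def map_bind_pmf map_snd_pair_pmf bind_map_pmf
        del: integral_map_pmf)
  ultimately have "EH m V1 (binomial_pmf n \<theta>) + EH m V2 (map_pmf (\<lambda>k. n - k) (binomial_pmf n \<theta>)) =
      measure_pmf.expectation (split_rgraph n) (\<lambda>(E1, E2). ?h V1 E1 + ?h V2 E2)"
    using finite_set_pmf_split_rgraph by (simp add: integrable_measure_pmf_finite case_prod_beta')
  also have "\<dots> = measure_pmf.expectation (split_rgraph n) (\<lambda>(E1, E2). ?h V (E1 @ E2))"
  proof (intro integral_cong_AE AE_pmfI)
    fix G assume "G \<in> set_pmf (split_rgraph n)"
    moreover obtain E1 E2 where G: "G = (E1, E2)" by fastforce
    ultimately have "wf_graph m V1 E1" "wf_graph m V2 E2"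
      using set_pmf_split_rgraphD by auto
    then show "(case G of (E1, E2) \<Rightarrow> ?h V1 E1 + ?h V2 E2) = (case G of (E1, E2) \<Rightarrow> ?h V (E1 @ E2))"
      using abs_HG_neq_infinity[OF valid] finite_nodes
      by (simp add: G HG_disjoint_union[OF valid finite_nodes disjoint_nodes] real_of_ereal_add)
  qed simp_all
  finally show ?thesis .
qed

lemma EH_superadditive:
  "EH m V1 (binomial_pmf n \<theta>) + EH m V2 (map_pmf (\<lambda>k. n - k) (binomial_pmf n \<theta>)) \<le>
    EH m V (return_pmf n)"
proof -
  let ?split = "map_pmf (\<lambda>(E1, E2). HG m V (E1 @ E2)) (split_rgraph n)"
  let ?whole = "map_pmf (HG m V) (rgraph m V n)"
  have finite_values: "\<bar>h\<bar> \<noteq> \<infinity>" if "h \<in> set_pmf ?split \<union> set_pmf ?whole" for h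
  proof -
    from that obtain E where "wf_graph m V E" "h = HG m V E"
      by (auto dest!: set_pmf_split_rgraphD(3) set_pmf_rgraphD(1)[OF finite_V nonempty_V])
    then show ?thesis by (simp add: abs_HG_neq_infinity[OF valid finite_V])
  qed
  have finite_support: "finite (set_pmf (map_pmf real_of_ereal ?split))"
    "finite (set_pmf (map_pmf real_of_ereal ?whole))"
    using finite_set_pmf_split_rgraph finite_set_pmf_rgraph[OF finite_V nonempty_V] by simp_all
  let ?S = "set_pmf (map_pmf real_of_ereal ?split) \<union> set_pmf (map_pmf real_of_ereal ?whole)"
  have "measure_pmf.expectation (map_pmf real_of_ereal ?split) (\<lambda>h. h) \<le>
      measure_pmf.expectation (map_pmf real_of_ereal ?whole) (\<lambda>h. h)"
    using finite_support
    by (intro stoch_le_imp_expectation_le[where a = "Min ?S"] stoch_le_map_real_of_ereal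
        stoch_le_HG_split_rgraph integrable_measure_pmf_finite finite_values Min_le finite_UnI)
  then show ?thesis
    unfolding EH_add_eq_expectation_split_rgraph by (simp add: EH_def bind_return_pmf case_prod_beta')
qed

lemma prob_split_rgraph_satisfiable_le:
  assumes csp: "is_csp m"
  shows "measure_pmf.prob (split_rgraph n) {(E1, E2). HG m V (E1 @ E2) = ereal (real n)} \<le>
    measure_pmf.prob (rgraph m V n) {E. HG m V E = ereal (real n)}"
proof -
  have "measure_pmf.prob (split_rgraph n) {(E1, E2). HG m V (E1 @ E2) = ereal (real n)} \<le>
      measure_pmf.prob (map_pmf (\<lambda>(E1, E2). HG m V (E1 @ E2)) (split_rgraph n)) {ereal (real n)..}"
    unfolding measure_map_pmf by (intro measure_pmf.finite_measure_mono) auto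
  also have "\<dots> \<le> measure_pmf.prob (map_pmf (HG m V) (rgraph m V n)) {ereal (real n)..}"
    using stoch_le_HG_split_rgraph by (simp add: stoch_le_def)
  also have "\<dots> = measure_pmf.prob (rgraph m V n) {E. HG m V E = ereal (real n)}"
    unfolding measure_map_pmf
  proof (intro measure_pmf.finite_measure_eq_AE AE_pmfI)
    fix E assume "E \<in> set_pmf (rgraph m V n)"
    then have "HG m V E \<le> ereal (real n)"
      using HG_le_length[OF csp valid finite_V] set_pmf_rgraphD(2)[OF finite_V nonempty_V] by metis
    then show "E \<in> HG m V -` {ereal (real n)..} \<longleftrightarrow> E \<in> {E. HG m V E = ereal (real n)}" by auto
  qed simp_all
  finally show ?thesis .
qed

lemma bind_pmf_eq_map_pmf_split_rgraph:
  "bind_pmf (binomial_pmf n \<theta>) (\<lambda>k. bind_pmf (rgraph m V1 k) (\<lambda>E1.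
      bind_pmf (rgraph m V2 (n - k)) (\<lambda>E2. return_pmf (k + (n - k), E1 @ E2)))) =
    map_pmf (\<lambda>(E1, E2). (n, E1 @ E2)) (split_rgraph n)"
proof -
  have "k + (n - k) = n" if "k \<in> set_pmf (binomial_pmf n \<theta>)" for k
    using that \<theta>_in_unit_interval by (auto simp: set_pmf_binomial_eq split: if_splits)
  then show ?thesis
    by (simp add: split_rgraph_def map_pmf_def pair_pmf_def bind_assoc_pmf bind_return_pmf
        cong: bind_pmf_cong)
qed

lemma prob_union_satisfiable_le:
  assumes "is_csp m"
  shows "measure_pmf.prob (bind_pmf (binomial_pmf n \<theta>) (\<lambda>k. bind_pmf (rgraph m V1 k) (\<lambda>E1.
      bind_pmf (rgraph m V2 (n - k)) (\<lambda>E2. return_pmf (k + (n - k), E1 @ E2)))))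
      {(M, E). HG m V E = ereal (real M)} \<le>
    measure_pmf.prob (rgraph m V n) {E. HG m V E = ereal (real n)}"
  using prob_split_rgraph_satisfiable_le[OF assms, of n]
  by (simp add: bind_pmf_eq_map_pmf_split_rgraph vimage_def case_prod_beta')

end

theorem theorem5:
  fixes m :: model and c :: real and N N1 N2 :: nat
  assumes "valid_model m" and "c > 0"
    and "1 \<le> N1" and "N1 \<le> N - 1" and "1 \<le> N2" and "N2 \<le> N - 1" and "N1 + N2 = N"
  shows "EH m {..<N} (return_pmf (nat \<lfloor>c * real N\<rfloor>))
           \<ge> EH m {..<N1} (binomial_pmf (nat \<lfloor>c * real N\<rfloor>) (real N1 / real N))
             + EH m {..<N2} (map_pmf (\<lambda>M1. nat \<lfloor>c * real N\<rfloor> - M1)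
                                (binomial_pmf (nat \<lfloor>c * real N\<rfloor>) (real N1 / real N)))
       \<and> (is_csp m \<longrightarrow>
           psat m N (nat \<lfloor>c * real N\<rfloor>)
           \<ge> measure_pmf.prob
               (bind_pmf (binomial_pmf (nat \<lfloor>c * real N\<rfloor>) (real N1 / real N)) (\<lambda>M1.
                  bind_pmf (rgraph m {..<N1} M1) (\<lambda>E1.
                  bind_pmf (rgraph m {N1..<N} (nat \<lfloor>c * real N\<rfloor> - M1)) (\<lambda>E2.
                  return_pmf (M1 + (nat \<lfloor>c * real N\<rfloor> - M1), E1 @ E2)))))
               {(M, E). HG m {..<N} E = ereal (real M)})"
proof -
  interpret node_split m "{..<N1}" "{N1..<N}"
    using assms by unfold_locales (auto simp: lessThan_empty_iff)
  have nodes: "{..<N1} \<union> {N1..<N} = {..<N}"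
    using assms by auto
  have "{N1..<N} = (\<lambda>i. i + N1) ` {..<N2}"
    using \<open>N1 + N2 = N\<close> by (simp add: image_add_atLeastLessThan' lessThan_atLeast0 add.commute)
  then have shift: "EH m {N1..<N} D = EH m {..<N2} D" for D
    using \<open>1 \<le> N2\<close> EH_image[of "\<lambda>i. i + N1" "{..<N2}" m D] by (simp add: lessThan_empty_iff)
  let ?n = "nat \<lfloor>c * real N\<rfloor>"
  show ?thesis
    using EH_superadditive[of ?n] prob_union_satisfiable_le[of ?n] by (simp add: nodes shift psat_def)
qed

end
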